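(* For all $\alpha,\beta\in\mathbb{C}$, $$\dim \mathrm{H}^1(\mathcal{W},\mathcal{F}_\alpha\otimes\mathcal{F}_\beta)=\begin{cases}5,&(\alpha,\beta)=(0,0);\\ 2,&(\alpha,\beta)=(0,1)\text{ or }(1,0);\\ 1,&(\alpha,\beta)\in\{(0,2),(2,0),(1,1)\}\text{ or }(\alpha+\beta=1,\ \beta\neq 0,1);\\ 0,&\text{otherwise.}\end{cases}$$
   Context: The Witt algebra $\mathcal{W}$ is the complex Lie algebra with basis $\{L_n\mid n\in\mathbb{Z}\}$ and bracket $[L_m,L_n]=(m-n)L_{m+n}$. For $\alpha\in\mathbb{C}$, the tensor density module $\mathcal{F}_\alpha$ has basis $\{v_n\mid n\in\mathbb{Z}\}$ with $L_m\cdot v_n=-(\alpha m+n)v_{m+n}$. The tensor product $\mathcal{F}_\alpha\otimes\mathcal{F}_\beta$ is a $\mathcal{W}$-module via $L_m\cdot(v_i\otimes v_j)=-(i+\alpha m)v_{m+i}\otimes v_j-(j+\beta m)v_i\otimes v_{m+j}$. For a Lie algebra $L$ and $L$-module $M$, $\mathrm{Der}(L,M)$ is the space of 1-cocycles (linear $d:L\to M$ with $d([x,y])=x\cdot d(y)-y\cdot d(x)$), $\mathrm{Inn}(L,M)$ the space of 1-coboundaries $d_v(x)=x\cdot v$ ($v\in M$), and $\mathrm{H}^1(L,M)=\mathrm{Der}(L,M)/\mathrm{Inn}(L,M)$. *)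

theory Defs
  imports Complex_Main
begin

text \<open>The Witt algebra W has basis L_n (n in Z); a linear map W to M is the same as
an arbitrary function from Z to M (its values on the basis).
The module F_alpha (x) F_beta has basis v_i (x) v_j; its elements are represented as
finitely supported coefficient functions Z x Z to C.\<close>

type_synonym tens = "int \<times> int \<Rightarrow> complex"

definition fin_supp :: "tens \<Rightarrow> bool" where
  "fin_supp f \<longleftrightarrow> finite {p. f p \<noteq> 0}"

text \<open>Action of L_m on F_alpha (x) F_beta, in coefficients:
 L_m (v_i (x) v_j) = -(i + alpha m) v_(m+i) (x) v_j - (j + beta m) v_i (x) v_(m+j).\<close>

definition tact :: "complex \<Rightarrow> complex \<Rightarrow> int \<Rightarrow> tens \<Rightarrow> tens" where
  "tact \<alpha> \<beta> m f = (\<lambda>(a, b).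
      - (of_int (a - m) + \<alpha> * of_int m) * f (a - m, b)
      - (of_int (b - m) + \<beta> * of_int m) * f (a, b - m))"

text \<open>1-cocycles: d([L_m,L_n]) = L_m . d(L_n) - L_n . d(L_m), with [L_m,L_n] = (m-n) L_(m+n).\<close>

definition Der :: "complex \<Rightarrow> complex \<Rightarrow> (int \<Rightarrow> tens) set" where
  "Der \<alpha> \<beta> = {d. (\<forall>n. fin_supp (d n)) \<and>
      (\<forall>m n p. of_int (m - n) * d (m + n) p = tact \<alpha> \<beta> m (d n) p - tact \<alpha> \<beta> n (d m) p)}"

definition Inn :: "complex \<Rightarrow> complex \<Rightarrow> (int \<Rightarrow> tens) set" where
  "Inn \<alpha> \<beta> = {d. \<exists>v. fin_supp v \<and> d = (\<lambda>m. tact \<alpha> \<beta> m v)}"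

definition H1_dim :: "complex \<Rightarrow> complex \<Rightarrow> nat \<Rightarrow> bool" where
  "H1_dim \<alpha> \<beta> k \<longleftrightarrow> (\<exists>ds :: nat \<Rightarrow> int \<Rightarrow> tens.
      (\<forall>i<k. ds i \<in> Der \<alpha> \<beta>) \<and>
      (\<forall>c :: nat \<Rightarrow> complex. (\<lambda>n p. \<Sum>i<k. c i * ds i n p) \<in> Inn \<alpha> \<beta> \<longrightarrow> (\<forall>i<k. c i = 0)) \<and>
      (\<forall>d \<in> Der \<alpha> \<beta>. \<exists>c :: nat \<Rightarrow> complex.
          (\<lambda>n p. d n p - (\<Sum>i<k. c i * ds i n p)) \<in> Inn \<alpha> \<beta>))"

end

theory Submission
  imports Defs
begin

text \<open>
Subtracting an inner derivation makes a cocycle homogeneous: d(L_n) is a combination of the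
v_i (x) v_(n-i). If k is the lowest index that occurs, with leading coefficients a_m of
v_k (x) v_(m-k) in d(L_m) for m > 0 and b_n of v_(k+n) (x) v_(-k) in d(L_n) for n < 0, then the
cocycle identity for (m, n) forces (beta m - k) b_n = (k + alpha n) a_m. For k different from 0
this says that the leading part is that of the inner derivation of a multiple of v_k (x) v_(-k),
which can be subtracted. Working from both ends, every class is represented by a ``box'' cocycle,
where d(L_n) only involves v_i (x) v_(n-i) with i between 0 and n; the same edge argument shows
that the representative is unique up to the inner derivation of v_0 (x) v_0. As W is generated by
L_1, L_2, L_(-1), L_(-2), a box cocycle is determined by ten numbers, and the identities for
(1,-1), (2,-1), (-2,1), (2,-2) already cut out the right dimension. The classes that survive come
from the modules F_0, F_1, F_2 (right_edge) and from formal coboundaries of half of the diagonal,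
the expansions of 1/(x-y), 1/(x-y)^2 and log(x-y) (half_diag).
\<close>

section \<open>The flip of the two factors and the edge conditions on cochains\<close>

definition swap :: "(int \<Rightarrow> tens) \<Rightarrow> int \<Rightarrow> tens" where
  "swap d n = (\<lambda>(a, b). d n (b, a))"

definition delta :: "int \<Rightarrow> int \<Rightarrow> tens" where
  "delta i j p = (if p = (i, j) then 1 else 0)"

text \<open>The bound k + min 0 n is the lowest first index in L_n (v_k (x) v_(-k)), so coboundaries
  of v_j (x) v_(-j) with j \<ge> k satisfy \<open>lower k\<close>. \<open>upper\<close> is the
  mirror image.\<close>

definition lower :: "int \<Rightarrow> (int \<Rightarrow> tens) \<Rightarrow> bool" where
  "lower k d \<longleftrightarrow> (\<forall>n a b. d n (a, b) \<noteq> 0 \<longrightarrow> a + b = n \<and> k + min 0 n \<le> a)"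

definition upper :: "int \<Rightarrow> (int \<Rightarrow> tens) \<Rightarrow> bool" where
  "upper k d \<longleftrightarrow> (\<forall>n a b. d n (a, b) \<noteq> 0 \<longrightarrow> a + b = n \<and> a \<le> k + max 0 n)"

abbreviation box :: "(int \<Rightarrow> tens) \<Rightarrow> bool" where
  "box d \<equiv> lower 0 d \<and> upper 0 d"

section \<open>The module action and finite support\<close>

lemma tact_apply:
  "tact \<alpha> \<beta> m f (a, b) =
     - (of_int (a - m) + \<alpha> * of_int m) * f (a - m, b)
     - (of_int (b - m) + \<beta> * of_int m) * f (a, b - m)"
  by (simp add: tact_def)

lemma tact_bracket:
  "of_int (m - n) * tact \<alpha> \<beta> (m + n) v p =
     tact \<alpha> \<beta> m (tact \<alpha> \<beta> n v) p - tact \<alpha> \<beta> n (tact \<alpha> \<beta> m v) p"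
proof (cases p)
  case (Pair a b)
  have e: "x - m - n = x - (m + n)" "x - n - m = x - (m + n)" for x :: int
    by simp_all
  show ?thesis
    unfolding Pair tact_apply e of_int_diff of_int_add by algebra
qed

text \<open>Linearity in the single shape f + c g shared by all the \<open>combine\<close> lemmas;
  sums are the case c = 1, scalar multiples the case f = 0.\<close>

lemma tact_combine:
  "tact \<alpha> \<beta> m (\<lambda>p. f p + c * g p) p = tact \<alpha> \<beta> m f p + c * tact \<alpha> \<beta> m g p"
  by (cases p) (simp add: tact_apply algebra_simps)

lemma tact_zero [simp]: "tact \<alpha> \<beta> m (\<lambda>p. 0) p = 0"
  by (cases p) (simp add: tact_apply)

lemma tact_swap: "tact \<beta> \<alpha> m (\<lambda>(a, b). f (b, a)) (a, b) = tact \<alpha> \<beta> m f (b, a)"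
  by (simp add: tact_apply algebra_simps)

lemma fin_supp_combine:
  assumes "fin_supp f" "fin_supp g"
  shows "fin_supp (\<lambda>p. f p + c * g p)"
  using assms unfolding fin_supp_def
  by (rule_tac finite_subset[of _ "{p. f p \<noteq> 0} \<union> {p. g p \<noteq> 0}"]) auto

lemma fin_supp_zero [simp]: "fin_supp (\<lambda>p. 0)"
  by (simp add: fin_supp_def)

lemma fin_supp_delta [simp]: "fin_supp (delta i j)"
  by (simp add: fin_supp_def delta_def)

lemma fin_supp_swap:
  assumes "fin_supp f"
  shows "fin_supp (\<lambda>(a, b). f (b, a))"
proof -
  have "{p. (case p of (a, b) \<Rightarrow> f (b, a)) \<noteq> 0} \<subseteq> prod.swap ` {p. f p \<noteq> 0}"
    by (auto simp: image_iff)
  then show ?thesis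
    using assms unfolding fin_supp_def by (rule finite_subset[OF _ finite_imageI])
qed

lemma fin_supp_tact:
  assumes "fin_supp v"
  shows "fin_supp (tact \<alpha> \<beta> m v)"
proof -
  have "{p. tact \<alpha> \<beta> m v p \<noteq> 0} \<subseteq>
      (\<lambda>(a, b). (a + m, b)) ` {p. v p \<noteq> 0} \<union> (\<lambda>(a, b). (a, b + m)) ` {p. v p \<noteq> 0}"
  proof
    fix p assume "p \<in> {p. tact \<alpha> \<beta> m v p \<noteq> 0}"
    then obtain a b where p: "p = (a, b)" and "v (a - m, b) \<noteq> 0 \<or> v (a, b - m) \<noteq> 0"
      by (cases p) (force simp: tact_apply)
    then show "p \<in> (\<lambda>(a, b). (a + m, b)) ` {p. v p \<noteq> 0} \<union> (\<lambda>(a, b). (a, b + m)) ` {p. v p \<noteq> 0}"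
      by (force simp: image_iff)
  qed
  then show ?thesis
    using assms unfolding fin_supp_def by (meson finite_UnI finite_imageI finite_subset)
qed

lemma fin_supp_box:
  assumes "box d"
  shows "fin_supp (d n)"
proof -
  have "{p. d n p \<noteq> 0} \<subseteq> (\<lambda>a. (a, n - a)) ` {min 0 n..max 0 n}"
  proof
    fix p assume "p \<in> {p. d n p \<noteq> 0}"
    then obtain a b where "p = (a, b)" "a + b = n" "0 + min 0 n \<le> a" "a \<le> 0 + max 0 n"
      using assms unfolding lower_def upper_def by (cases p) blast
    then show "p \<in> (\<lambda>a. (a, n - a)) ` {min 0 n..max 0 n}"
      by (auto simp: image_iff)
  qed
  then show ?thesis
    unfolding fin_supp_def by (rule finite_subset) simp
qed

section \<open>Cocycles, coboundaries and the flip symmetry\<close>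

lemma Der_bracket:
  assumes "d \<in> Der \<alpha> \<beta>"
  shows "of_int (m - n) * d (m + n) (a, b) =
      - (of_int (a - m) + \<alpha> * of_int m) * d n (a - m, b)
      - (of_int (b - m) + \<beta> * of_int m) * d n (a, b - m)
      + (of_int (a - n) + \<alpha> * of_int n) * d m (a - n, b)
      + (of_int (b - n) + \<beta> * of_int n) * d m (a, b - n)"
proof -
  have "of_int (m - n) * d (m + n) (a, b) =
      tact \<alpha> \<beta> m (d n) (a, b) - tact \<alpha> \<beta> n (d m) (a, b)"
    using assms by (simp add: Der_def)
  then show ?thesis
    unfolding tact_apply by algebra
qed

lemma Der_combine:
  assumes "d \<in> Der \<alpha> \<beta>" "e \<in> Der \<alpha> \<beta>"
  shows "(\<lambda>n p. d n p + c * e n p) \<in> Der \<alpha> \<beta>"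
proof -
  have "of_int (m - n) * (d (m + n) p + c * e (m + n) p) =
      tact \<alpha> \<beta> m (\<lambda>p. d n p + c * e n p) p - tact \<alpha> \<beta> n (\<lambda>p. d m p + c * e m p) p" for m n p
  proof -
    have "of_int (m - n) * d (m + n) p = tact \<alpha> \<beta> m (d n) p - tact \<alpha> \<beta> n (d m) p"
      and "of_int (m - n) * e (m + n) p = tact \<alpha> \<beta> m (e n) p - tact \<alpha> \<beta> n (e m) p"
      using assms by (simp_all add: Der_def del: of_int_diff split_paired_All)
    then show ?thesis
      unfolding tact_combine by algebra
  qed
  then show ?thesis
    using assms by (simp add: Der_def fin_supp_combine)
qed

lemma Der_zero: "(\<lambda>n p. 0) \<in> Der \<alpha> \<beta>"
  by (simp add: Der_def)

lemma Der_sum: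
  fixes k :: nat
  assumes "\<And>i. i < k \<Longrightarrow> ds i \<in> Der \<alpha> \<beta>"
  shows "(\<lambda>n p. \<Sum>i<k. c i * ds i n p) \<in> Der \<alpha> \<beta>"
  using assms
proof (induction k)
  case 0
  then show ?case by (simp add: Der_zero)
next
  case (Suc k)
  then show ?case
    using Der_combine[of "\<lambda>n p. \<Sum>i<k. c i * ds i n p" \<alpha> \<beta> "ds k" "c k"] by simp
qed

text \<open>Finite support is asked of the values only, not of v: the formal coboundaries of
  infinite sums enter through this lemma.\<close>

lemma tact_Der:
  assumes "\<And>m. fin_supp (tact \<alpha> \<beta> m v)"
  shows "(\<lambda>m. tact \<alpha> \<beta> m v) \<in> Der \<alpha> \<beta>"
  using assms by (simp add: Der_def tact_bracket del: of_int_diff split_paired_All)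

lemma inner_Der: "fin_supp v \<Longrightarrow> (\<lambda>m. tact \<alpha> \<beta> m v) \<in> Der \<alpha> \<beta>"
  by (rule tact_Der) (rule fin_supp_tact)

lemma swap_involution [simp]: "swap (swap d) = d"
  by (auto simp: swap_def fun_eq_iff)

lemma swap_Der:
  assumes "d \<in> Der \<alpha> \<beta>"
  shows "swap d \<in> Der \<beta> \<alpha>"
  using assms unfolding Der_def
  by (auto simp: swap_def fin_supp_swap tact_swap)

lemma swap_Inn:
  assumes "d \<in> Inn \<alpha> \<beta>"
  shows "swap d \<in> Inn \<beta> \<alpha>"
proof -
  obtain v where v: "fin_supp v" "d = (\<lambda>m. tact \<alpha> \<beta> m v)"
    using assms by (auto simp: Inn_def)
  then have "swap d = (\<lambda>m. tact \<beta> \<alpha> m (\<lambda>(a, b). v (b, a)))"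
    by (auto simp: swap_def fun_eq_iff tact_swap)
  then show ?thesis
    using v fin_supp_swap unfolding Inn_def by blast
qed

lemma H1_dim_swap:
  assumes "H1_dim \<alpha> \<beta> k"
  shows "H1_dim \<beta> \<alpha> k"
proof -
  obtain ds where D: "\<And>i. i < k \<Longrightarrow> ds i \<in> Der \<alpha> \<beta>"
    and I: "\<And>c. (\<lambda>n p. \<Sum>i<k. c i * ds i n p) \<in> Inn \<alpha> \<beta> \<Longrightarrow> \<forall>i<k. c i = 0"
    and S: "\<And>d. d \<in> Der \<alpha> \<beta> \<Longrightarrow> \<exists>c. (\<lambda>n p. d n p - (\<Sum>i<k. c i * ds i n p)) \<in> Inn \<alpha> \<beta>"
    using assms unfolding H1_dim_def by blast
  have 1: "\<forall>i<k. c i = 0" if "(\<lambda>n p. \<Sum>i<k. c i * swap (ds i) n p) \<in> Inn \<beta> \<alpha>" for c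
  proof -
    have "swap (\<lambda>n p. \<Sum>i<k. c i * swap (ds i) n p) = (\<lambda>n p. \<Sum>i<k. c i * ds i n p)"
      by (auto simp: swap_def fun_eq_iff)
    then show ?thesis
      using swap_Inn[OF that] I by simp
  qed
  have 2: "\<exists>c. (\<lambda>n p. d n p - (\<Sum>i<k. c i * swap (ds i) n p)) \<in> Inn \<beta> \<alpha>"
    if d: "d \<in> Der \<beta> \<alpha>" for d
  proof -
    obtain c where "(\<lambda>n p. swap d n p - (\<Sum>i<k. c i * ds i n p)) \<in> Inn \<alpha> \<beta>"
      using S[OF swap_Der[OF d]] by blast
    moreover have "swap (\<lambda>n p. swap d n p - (\<Sum>i<k. c i * ds i n p)) =
        (\<lambda>n p. d n p - (\<Sum>i<k. c i * swap (ds i) n p))"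
      by (auto simp: swap_def fun_eq_iff)
    ultimately show ?thesis
      using swap_Inn by fastforce
  qed
  show ?thesis
    unfolding H1_dim_def
  proof (intro exI[of _ "\<lambda>i. swap (ds i)"] conjI)
    show "\<forall>i<k. swap (ds i) \<in> Der \<beta> \<alpha>" using D swap_Der by blast
  qed (use 1 in meson, use 2 in meson)
qed

section \<open>Removing the edges of a homogeneous cocycle\<close>

lemma lower_vanish: "lower k d \<Longrightarrow> a < k + min 0 n \<Longrightarrow> d n (a, b) = 0"
  by (force simp: lower_def)

lemma lower_combine: "lower k d \<Longrightarrow> lower k e \<Longrightarrow> lower k (\<lambda>n p. d n p + c * e n p)"
  unfolding lower_def by (metis (no_types, lifting) add_0 mult_zero_right)

lemma upper_combine: "upper k d \<Longrightarrow> upper k e \<Longrightarrow> upper k (\<lambda>n p. d n p + c * e n p)"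
  unfolding upper_def by (metis (no_types, lifting) add_0 mult_zero_right)

text \<open>With a + b = n the lower bound on a becomes an upper bound on b, because n - min 0 n =
  max 0 n.\<close>

lemma lower_swap: "lower k d \<Longrightarrow> upper (- k) (swap d)"
  unfolding lower_def upper_def swap_def by fastforce

lemma upper_swap: "upper k d \<Longrightarrow> lower (- k) (swap d)"
  unfolding lower_def upper_def swap_def by fastforce

lemma box_sum:
  fixes k :: nat
  assumes "\<And>i. i < k \<Longrightarrow> box (ds i)"
  shows "box (\<lambda>n p. \<Sum>i<k. c i * ds i n p)"
  using assms
proof (induction k)
  case 0
  then show ?case by (simp add: lower_def upper_def)
next
  case (Suc k)
  then show ?case
    using lower_combine[of 0 "\<lambda>n p. \<Sum>i<k. c i * ds i n p" "ds k" "c k"]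
      upper_combine[of 0 "\<lambda>n p. \<Sum>i<k. c i * ds i n p" "ds k" "c k"] by simp
qed

lemma lower_delta: "lower k (\<lambda>m. tact \<alpha> \<beta> m (delta k (- k)))"
  unfolding lower_def by (auto simp: tact_apply delta_def split: if_splits)

lemma upper_delta: "k \<le> K \<Longrightarrow> upper K (\<lambda>m. tact \<alpha> \<beta> m (delta k (- k)))"
  unfolding upper_def by (auto simp: tact_apply delta_def split: if_splits)

lemma lower_step:
  assumes d: "d \<in> Der \<alpha> \<beta>" and l: "lower k d" and k: "k \<noteq> 0"
  obtains c where "lower (k + 1) (\<lambda>n p. d n p + c * tact \<alpha> \<beta> n (delta k (- k)) p)"
proof -
  have mixed: "(\<beta> * of_int m - of_int k) * d n (k + n, - k) = (of_int k + \<alpha> * of_int n) * d m (k, m - k)"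
    if "m > 0" "n < 0" for m n
  proof -
    \<comment> \<open>At (k + n, m - k) the left side of the cocycle identity and two of the four
      terms on the right lie below the edge; one leading coefficient of \<open>d n\<close> and one
      of \<open>d m\<close> survive.\<close>
    have z: "d (m + n) (k + n, m - k) = 0" "d n (k + n - m, m - k) = 0" "d m (k + n, m - k - n) = 0"
      by (rule lower_vanish[OF l], use that in simp)+
    show ?thesis
      using Der_bracket[OF d, of m n "k + n" "m - k"] z by (simp add: algebra_simps)
  qed
  \<comment> \<open>The factor can vanish at n = -1 only if alpha = k, and then it equals -k at n =
    -2. This is where k \<noteq> 0 enters; \<open>m0\<close> is found in the same way.\<close>
  obtain n0 :: int where n0: "n0 < 0" "of_int k + \<alpha> * of_int n0 \<noteq> 0"
  proof (cases "\<alpha> = of_int k")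
    case True
    then show ?thesis using that[of "-2"] k by simp
  next
    case False
    then show ?thesis using that[of "-1"] by simp
  qed
  obtain m0 :: int where m0: "m0 > 0" "\<beta> * of_int m0 - of_int k \<noteq> 0"
  proof (cases "\<beta> = of_int k")
    case True
    then show ?thesis using that[of 2] k by simp
  next
    case False
    then show ?thesis using that[of 1] by simp
  qed
  \<comment> \<open>One nonzero factor on each side of \<open>mixed\<close> makes this ratio govern
    all leading coefficients, first for m > 0 and then, through \<open>m0\<close>, for n <
    0.\<close>
  define c where "c = d n0 (k + n0, - k) / (of_int k + \<alpha> * of_int n0)"
  have a: "d m (k, m - k) = c * (\<beta> * of_int m - of_int k)" if "m > 0" for m
    using mixed[OF that n0(1)] n0(2) by (simp add: c_def field_simps)
  have b: "d n (k + n, - k) = c * (of_int k + \<alpha> * of_int n)" if "n < 0" for n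
    using mixed[OF m0(1) that] m0(2) by (simp add: a[OF m0(1)])
  have e: "d 0 (k, - k) = 0"
  proof -
    \<comment> \<open>In the identity for (m0, 0) the terms in \<open>d m0\<close> cancel, since L_0
      acts by the weight; what remains is (beta m0 - k) d 0 (k, -k) = 0.\<close>
    have "d 0 (k - m0, m0 - k) = 0"
      by (rule lower_vanish[OF l]) (use m0 in simp)
    then show ?thesis
      using Der_bracket[OF d, of m0 0 k "m0 - k"] m0 by (simp add: algebra_simps)
  qed
  have "lower (k + 1) (\<lambda>n p. d n p + c * tact \<alpha> \<beta> n (delta k (- k)) p)"
    unfolding lower_def
  proof (intro allI impI)
    fix n x y
    assume nz: "d n (x, y) + c * tact \<alpha> \<beta> n (delta k (- k)) (x, y) \<noteq> 0"
    then have s: "x + y = n \<and> k + min 0 n \<le> x"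
      using lower_combine[OF l lower_delta, of c \<alpha> \<beta>] unfolding lower_def by blast
    moreover have "x \<noteq> k + min 0 n"
    proof
      assume x: "x = k + min 0 n"
      consider "n > 0" | "n = 0" | "n < 0" by linarith
      then show False
      proof cases
        case 1
        then have xy: "x = k" "y = n - k" using x s by auto
        have "tact \<alpha> \<beta> n (delta k (- k)) (k, n - k) = of_int k - \<beta> * of_int n"
          using 1 by (simp add: tact_apply delta_def)
        then show False using nz unfolding xy a[OF 1] by (simp add: right_diff_distrib)
      next
        case 2
        then have "x = k" "y = - k" using x s by auto
        then show False using nz e 2 by (simp add: tact_apply delta_def)
      next
        case 3
        then have "x = k + n" "y = - k" using x s by auto
        then show False using nz b[OF 3] 3 by (simp add: tact_apply delta_def algebra_simps)
      qed
    qed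
    ultimately show "x + y = n \<and> k + 1 + min 0 n \<le> x" by linarith
  qed
  then show thesis by (rule that)
qed

text \<open>The edge climbs from -N to 0 through negative k only, so the exceptional index 0 is
  never met, and v_k (x) v_(-k) with k < 0 \<le> K does not disturb the upper edge.\<close>

lemma lower_reduce:
  assumes "d \<in> Der \<alpha> \<beta>" "lower (- int N) d" "upper K d" "0 \<le> K"
  shows "\<exists>v. fin_supp v \<and> lower 0 (\<lambda>n p. d n p + tact \<alpha> \<beta> n v p)
    \<and> upper K (\<lambda>n p. d n p + tact \<alpha> \<beta> n v p)"
  using assms
proof (induction N arbitrary: d)
  case 0
  then show ?case by (intro exI[of _ "\<lambda>p. 0"]) simp
next
  case (Suc N)
  let ?k = "- int (Suc N)"
  obtain c where c: "lower (?k + 1) (\<lambda>n p. d n p + c * tact \<alpha> \<beta> n (delta ?k (- ?k)) p)"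
    by (rule lower_step[OF Suc.prems(1,2)]) simp
  let ?e = "\<lambda>n p. d n p + c * tact \<alpha> \<beta> n (delta ?k (- ?k)) p"
  have "?e \<in> Der \<alpha> \<beta>"
    by (rule Der_combine[OF Suc.prems(1) inner_Der]) simp
  moreover have "lower (- int N) ?e"
    using c by (simp add: algebra_simps)
  moreover have "upper K ?e"
    by (rule upper_combine[OF Suc.prems(3) upper_delta]) (use Suc.prems(4) in simp)
  ultimately obtain v where v: "fin_supp v" "lower 0 (\<lambda>n p. ?e n p + tact \<alpha> \<beta> n v p)"
    "upper K (\<lambda>n p. ?e n p + tact \<alpha> \<beta> n v p)"
    using Suc.IH Suc.prems(4) by blast
  have "(\<lambda>n p. ?e n p + tact \<alpha> \<beta> n v p) = (\<lambda>n p. d n p + tact \<alpha> \<beta> n (\<lambda>p. v p + c * delta ?k (- ?k) p) p)"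
    by (simp add: tact_combine fun_eq_iff)
  then show ?case
    using v fin_supp_combine[OF v(1) fin_supp_delta]
    by (intro exI[of _ "\<lambda>p. v p + c * delta ?k (- ?k) p"]) simp
qed

section \<open>Generation of W by L_1, L_2, L_(-1), L_(-2)\<close>

text \<open>The induction follows [L_n, L_1] = (n-1) L_(n+1) and [L_n, L_(-1)] = (n+1) L_(n-1).
  These brackets vanish at n = 1 and n = -1, so 2 and -2 have to be base cases.\<close>

lemma int_window_induct:
  fixes P :: "int \<Rightarrow> bool"
  assumes "P (- 2)" "P (- 1)" "P 0" "P 1" "P 2"
    and up: "\<And>n. 2 \<le> n \<Longrightarrow> P n \<Longrightarrow> P (n + 1)"
    and down: "\<And>n. n \<le> - 2 \<Longrightarrow> P n \<Longrightarrow> P (n - 1)"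
  shows "P n"
proof -
  consider "n \<ge> 2" | "n = 1" | "n = 0" | "n = - 1" | "n \<le> - 2" by linarith
  then show ?thesis
  proof cases
    case 1
    then show ?thesis by (induction rule: int_ge_induct) (use assms in auto)
  next
    case 5
    then show ?thesis by (induction rule: int_le_induct) (use assms in auto)
  qed (use assms in auto)
qed

lemma Der_up:
  assumes "d \<in> Der \<alpha> \<beta>" "2 \<le> n"
    "d 1 (a - n, b) = 0" "d 1 (a, b - n) = 0" "d n (a - 1, b) = 0" "d n (a, b - 1) = 0"
  shows "d (n + 1) (a, b) = 0"
  using Der_bracket[OF assms(1), of n 1 a b] assms(2-) by (simp add: algebra_simps)

lemma Der_down:
  assumes "d \<in> Der \<alpha> \<beta>" "n \<le> - 2"
    "d (- 1) (a - n, b) = 0" "d (- 1) (a, b - n) = 0" "d n (a + 1, b) = 0" "d n (a, b + 1) = 0"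
  shows "d (n - 1) (a, b) = 0"
proof -
  have "of_int (n + 1) * d (n - 1) (a, b) = 0"
    using Der_bracket[OF assms(1), of n "- 1" a b] assms(3-) by (simp add: algebra_simps)
  moreover have "of_int (n + 1) \<noteq> (0 :: complex)" using assms(2) by (simp del: of_int_add)
  ultimately show ?thesis by simp
qed

lemma Der_generated:
  assumes d: "d \<in> Der \<alpha> \<beta>" and "\<And>n p. n \<in> {1, 2, - 1, - 2} \<Longrightarrow> d n p = 0"
  shows "d n p = 0"
proof -
  have g: "d 1 p = 0" "d 2 p = 0" "d (- 1) p = 0" "d (- 2) p = 0" for p
    using assms(2) by auto
  have "\<forall>p. d n p = 0"
  proof (rule int_window_induct[where n = n])
    \<comment> \<open>Here [L_1, L_(-1)] = 2 L_0 is used.\<close>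
    show "\<forall>p. d 0 p = 0"
      using Der_bracket[OF d, of 1 "- 1"] g by auto
  qed (use g Der_up[OF d] Der_down[OF d] in auto)
  then show ?thesis ..
qed

text \<open>Finite support alone bounds each degree separately. The five base degrees give a common
  bound, and bracketing with L_1 or L_(-1) propagates it in the form k + min 0 n.\<close>

lemma lower_exists:
  assumes d: "d \<in> Der \<alpha> \<beta>" and h: "\<And>n a b. d n (a, b) \<noteq> 0 \<Longrightarrow> a + b = n"
  obtains N where "lower (- int N) d"
proof -
  have "finite (\<Union>n\<in>{- 2, - 1, 0, 1, 2}. {p. d n p \<noteq> 0})"
    using d by (simp add: Der_def fin_supp_def)
  then have "finite ((\<lambda>p. \<bar>fst p\<bar>) ` (\<Union>n\<in>{- 2, - 1, 0, 1, 2}. {p. d n p \<noteq> 0}))"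
    by (rule finite_imageI)
  then obtain M where "\<forall>x\<in>(\<lambda>p. \<bar>fst p\<bar>) ` (\<Union>n\<in>{- 2, - 1, 0, 1, 2}. {p. d n p \<noteq> 0}). x \<le> M"
    by (meson bdd_above_def bdd_above_finite)
  then have M: "\<bar>a\<bar> \<le> M" if "n \<in> {- 2, - 1, 0, 1, 2}" "d n (a, b) \<noteq> 0" for n a b
    using that by force
  define k where "k = - int (nat M)"
  have base: "k + min 0 n \<le> a" if "n \<in> {- 2, - 1, 0, 1, 2}" "d n (a, b) \<noteq> 0" for n a b
    using M[OF that] by (auto simp: k_def)
  have "\<forall>a b. d n (a, b) \<noteq> 0 \<longrightarrow> k + min 0 n \<le> a" for n
  proof (rule int_window_induct[where n = n])
    fix n :: int
    assume n: "2 \<le> n" and IH: "\<forall>a b. d n (a, b) \<noteq> 0 \<longrightarrow> k + min 0 n \<le> a"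
    show "\<forall>a b. d (n + 1) (a, b) \<noteq> 0 \<longrightarrow> k + min 0 (n + 1) \<le> a"
    proof (intro allI, rule ccontr)
      fix a b assume A: "\<not> (d (n + 1) (a, b) \<noteq> 0 \<longrightarrow> k + min 0 (n + 1) \<le> a)"
      then have "a < k" using n by simp
      then have "d 1 (a - n, b) = 0" "d 1 (a, b - n) = 0" "d n (a - 1, b) = 0" "d n (a, b - 1) = 0"
        using base[of 1] IH n by force+
      then show False using A Der_up[OF d n] by blast
    qed
  next
    fix n :: int
    assume n: "n \<le> - 2" and IH: "\<forall>a b. d n (a, b) \<noteq> 0 \<longrightarrow> k + min 0 n \<le> a"
    show "\<forall>a b. d (n - 1) (a, b) \<noteq> 0 \<longrightarrow> k + min 0 (n - 1) \<le> a"
    proof (intro allI, rule ccontr)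
      fix a b assume A: "\<not> (d (n - 1) (a, b) \<noteq> 0 \<longrightarrow> k + min 0 (n - 1) \<le> a)"
      then have "a < k + n - 1" using n by simp
      then have "d (- 1) (a - n, b) = 0" "d (- 1) (a, b - n) = 0" "d n (a + 1, b) = 0" "d n (a, b + 1) = 0"
        using base[of "- 1"] IH n by force+
      then show False using A Der_down[OF d n] by blast
    qed
  qed (use base in blast)+
  then have "lower k d" unfolding lower_def using h by blast
  then show thesis using that k_def by blast
qed

section \<open>Existence and uniqueness of box representatives\<close>

text \<open>L_0 acts on v_a (x) v_b by the scalar -(a + b). By the identity for (0, n), dividing
  \<open>d 0\<close> by the weight, away from weight 0, gives a primitive of the part of d that does
  not preserve the grading.\<close>

lemma homogeneous_reduce:
  assumes d: "d \<in> Der \<alpha> \<beta>"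
  obtains v where "fin_supp v" "\<And>n a b. d n (a, b) + tact \<alpha> \<beta> n v (a, b) \<noteq> 0 \<Longrightarrow> a + b = n"
proof -
  define v :: tens where "v = (\<lambda>(a, b). if a + b = 0 then 0 else d 0 (a, b) / of_int (a + b))"
  have "{p. v p \<noteq> 0} \<subseteq> {p. d 0 p \<noteq> 0}" by (auto simp: v_def split: if_splits)
  then have "fin_supp v"
    using d unfolding fin_supp_def Der_def by (auto intro: finite_subset)
  moreover have "d n (a, b) + tact \<alpha> \<beta> n v (a, b) = 0" if "a + b \<noteq> n" for n a b
  proof -
    have z: "of_int (a + b - n) \<noteq> (0 :: complex)" using that by (metis eq_iff_diff_eq_0 of_int_eq_0_iff)
    have "v (a - n, b) = d 0 (a - n, b) / of_int (a + b - n)" "v (a, b - n) = d 0 (a, b - n) / of_int (a + b - n)"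
      using that by (auto simp: v_def algebra_simps)
    then have "of_int (a + b - n) * tact \<alpha> \<beta> n v (a, b) = tact \<alpha> \<beta> n (d 0) (a, b)"
      using z unfolding tact_apply by (simp add: field_simps del: of_int_diff of_int_add)
    also have "\<dots> = - of_int (a + b - n) * d n (a, b)"
      using Der_bracket[OF d, of 0 n a b] by (simp add: tact_apply algebra_simps)
    finally have "of_int (a + b - n) * (d n (a, b) + tact \<alpha> \<beta> n v (a, b)) = 0"
      by (simp add: algebra_simps)
    then show ?thesis using z by (metis mult_eq_0_iff)
  qed
  ultimately show thesis using that by blast
qed

lemma box_reduce:
  assumes d: "d \<in> Der \<alpha> \<beta>"
  obtains v where "fin_supp v" "box (\<lambda>n p. d n p + tact \<alpha> \<beta> n v p)"
proof -
  obtain v1 where v1: "fin_supp v1" "\<And>n a b. d n (a, b) + tact \<alpha> \<beta> n v1 (a, b) \<noteq> 0 \<Longrightarrow> a + b = n"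
    using homogeneous_reduce[OF d] by metis
  define d1 where "d1 = (\<lambda>n p. d n p + tact \<alpha> \<beta> n v1 p)"
  have D1: "d1 \<in> Der \<alpha> \<beta>"
    using Der_combine[OF d inner_Der[OF v1(1)], of 1] by (simp add: d1_def)
  have h: "a + b = n" if "d1 n (a, b) \<noteq> 0" for n a b
    using v1(2) that by (simp add: d1_def)
  obtain N where N: "lower (- int N) d1"
    using lower_exists[OF D1 h] by blast
  have h': "a + b = n" if "swap d1 n (a, b) \<noteq> 0" for n a b
    using h[of n b a] that by (simp add: swap_def)
  obtain M where M: "lower (- int M) (swap d1)"
    using lower_exists[OF swap_Der[OF D1] h'] by blast
  have U: "upper (int M) d1" using lower_swap[OF M] by simp
  obtain v2 where v2: "fin_supp v2" "lower 0 (\<lambda>n p. d1 n p + tact \<alpha> \<beta> n v2 p)"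
    "upper (int M) (\<lambda>n p. d1 n p + tact \<alpha> \<beta> n v2 p)"
    using lower_reduce[OF D1 N U] by auto
  define d2 where "d2 = (\<lambda>n p. d1 n p + tact \<alpha> \<beta> n v2 p)"
  have D2: "d2 \<in> Der \<alpha> \<beta>"
    using Der_combine[OF D1 inner_Der[OF v2(1)], of 1] by (simp add: d2_def)
  \<comment> \<open>The lower edge already gained becomes an upper edge of the flip, and
    \<open>lower_reduce\<close> with K = 0 keeps it while the other edge is removed.\<close>
  have "lower (- int M) (swap d2)" "upper 0 (swap d2)"
    using upper_swap[OF v2(3)] lower_swap[OF v2(2)] by (simp_all add: d2_def)
  then obtain v3 where v3: "fin_supp v3" "lower 0 (\<lambda>n p. swap d2 n p + tact \<beta> \<alpha> n v3 p)"
    "upper 0 (\<lambda>n p. swap d2 n p + tact \<beta> \<alpha> n v3 p)"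
    using lower_reduce[OF swap_Der[OF D2]] by blast
  define w where "w = (\<lambda>p. v1 p + 1 * (v2 p + 1 * (\<lambda>(a, b). v3 (b, a)) p))"
  have "swap (\<lambda>n p. swap d2 n p + tact \<beta> \<alpha> n v3 p) = (\<lambda>n p. d n p + tact \<alpha> \<beta> n w p)"
    unfolding w_def tact_combine
    by (auto simp: swap_def fun_eq_iff tact_swap d1_def d2_def)
  then have "box (\<lambda>n p. d n p + tact \<alpha> \<beta> n w p)"
    using lower_swap[OF v3(2)] upper_swap[OF v3(3)] by simp
  moreover have "fin_supp w"
    unfolding w_def using v1 v2 v3 fin_supp_combine fin_supp_swap by blast
  ultimately show thesis using that by blast
qed

text \<open>L_0 forces v onto the diagonal a + b = 0. If its least index l were negative, the
  coefficient of v_l (x) v_(m-l) in L_m v would leave the box unless beta m = l for every m > 0; m =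
  1 and m = 2 contradict this. The greatest index is treated in the same way with alpha.\<close>

lemma inner_box_unique:
  assumes v: "fin_supp v" and box: "box (\<lambda>n. tact \<alpha> \<beta> n v)"
  obtains t where "v = (\<lambda>p. t * delta 0 0 p)"
proof -
  have low: "tact \<alpha> \<beta> n v (a, b) = 0" if "a < min 0 n" for n a b
    using box that lower_vanish[of 0 "\<lambda>n. tact \<alpha> \<beta> n v" a n b] by simp
  have upp: "tact \<alpha> \<beta> n v (a, b) = 0" if "max 0 n < a" for n a b
    using box that unfolding upper_def by force
  have h: "v (a, b) = 0" if "a + b \<noteq> 0" for a b
  proof -
    have "tact \<alpha> \<beta> 0 v (a, b) = 0"
      using box that unfolding lower_def by blast
    moreover have "of_int a + of_int b \<noteq> (0 :: complex)"
      using that by (metis of_int_add of_int_eq_0_iff)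
    moreover have "tact \<alpha> \<beta> 0 v (a, b) = - (of_int a + of_int b) * v (a, b)"
      by (simp add: tact_apply algebra_simps)
    ultimately show ?thesis by (metis mult_eq_0_iff neg_equal_0_iff_equal)
  qed
  define S where "S = {a. v (a, - a) \<noteq> 0}"
  have "S \<subseteq> fst ` {p. v p \<noteq> 0}" by (force simp: S_def)
  then have fS: "finite S"
    using v unfolding fin_supp_def by (meson finite_imageI finite_subset)
  have ge: "0 \<le> k" if "k \<in> S" for k
  proof (rule ccontr)
    assume "\<not> 0 \<le> k"
    define l where "l = Min S"
    have l: "l \<in> S" "\<And>x. x < l \<Longrightarrow> v (x, - x) = 0" "l < 0"
      using that \<open>\<not> 0 \<le> k\<close> Min_in[OF fS] Min_le[OF fS] unfolding l_def
      by (blast, metis (mono_tags) S_def linorder_not_less mem_Collect_eq, force)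
    have "(\<beta> * of_int m - of_int l) * v (l, - l) = 0" if "m > 0" for m
      using low[of l m "m - l"] l(2)[of "l - m"] l(3) that by (auto simp: tact_apply algebra_simps)
    from this[of 1] this[of 2] have "\<beta> = of_int l" "\<beta> * 2 = of_int l"
      using l(1) by (auto simp: S_def)
    then show False using l(3) by simp
  qed
  have le: "k \<le> 0" if "k \<in> S" for k
  proof (rule ccontr)
    assume "\<not> k \<le> 0"
    define l where "l = Max S"
    have l: "l \<in> S" "\<And>x. x > l \<Longrightarrow> v (x, - x) = 0" "l > 0"
      using that \<open>\<not> k \<le> 0\<close> Max_in[OF fS] Max_ge[OF fS] unfolding l_def
      by (blast, metis (mono_tags) S_def linorder_not_less mem_Collect_eq, force)
    have "(of_int l + \<alpha> * of_int m) * v (l, - l) = 0" if "m > 0" for m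
      using upp[of m "l + m" "- l"] l(2)[of "l + m"] l(3) that by (simp add: tact_apply algebra_simps)
    from this[of 1] this[of 2] have "of_int l + \<alpha> = 0" "of_int l + \<alpha> * 2 = 0"
      using l(1) by (auto simp: S_def)
    then have "of_int l = (0 :: complex)"
      by (metis add.right_neutral add_diff_cancel_left' diff_self mult_2_right)
    then show False using l(3) by simp
  qed
  have "v p = v (0, 0) * delta 0 0 p" for p
  proof (cases p)
    case (Pair a b)
    show ?thesis
    proof (cases "v p = 0")
      case True
      then show ?thesis by (auto simp: delta_def)
    next
      case False
      then have "b = - a" using h[of a b] Pair by force
      then have "a = 0" using ge[of a] le[of a] False Pair by (auto simp: S_def)
      then show ?thesis using Pair \<open>b = - a\<close> by (simp add: delta_def)
    qed
  qed
  then show thesis using that by blast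
qed

section \<open>Reduction of the dimension count to linear algebra\<close>

text \<open>These are all the box positions in degrees 1, 2, -1, -2, in a fixed order that later
  proofs address by \<open>!\<close>. Position (0, 0) in degree 0 follows from [L_1, L_(-1)] = 2
  L_0.\<close>

definition coords :: "(int \<Rightarrow> tens) \<Rightarrow> complex list" where
  "coords d = [d 1 (0, 1), d 1 (1, 0), d 2 (0, 2), d 2 (1, 1), d 2 (2, 0),
     d (- 1) (0, - 1), d (- 1) (- 1, 0), d (- 2) (0, - 2), d (- 2) (- 1, - 1), d (- 2) (- 2, 0)]"

lemma box_vanish:
  "box d \<Longrightarrow> \<not> (a + b = n \<and> min 0 n \<le> a \<and> a \<le> max 0 n) \<Longrightarrow> d n (a, b) = 0"
  unfolding lower_def upper_def by (metis add_0)

lemma box_eqI: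
  assumes "d \<in> Der \<alpha> \<beta>" "e \<in> Der \<alpha> \<beta>" "box d" "box e" "coords d = coords e"
  shows "d = e"
proof -
  let ?f = "\<lambda>n p. d n p + (- 1) * e n p"
  have b: "box ?f" using assms(3,4) lower_combine upper_combine by blast
  have "?f n p = 0" if "n \<in> {1, 2, - 1, - 2}" for n p
  proof (cases p)
    case (Pair x y)
    show ?thesis
    proof (cases "x + y = n \<and> min 0 n \<le> x \<and> x \<le> max 0 n")
      case True
      then have y: "y = n - x" and x: "min 0 n \<le> x" "x \<le> max 0 n" by simp_all
      then have "x = - 2 \<or> x = - 1 \<or> x = 0 \<or> x = 1 \<or> x = 2"
        using that by auto
      then have "?f n (x, n - x) = 0"
        using that assms(5) x by (elim disjE) (auto simp: coords_def)
      then show ?thesis using Pair y by simp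
    next
      case False
      then show ?thesis using box_vanish[OF b False] Pair by simp
    qed
  qed
  then have "?f n p = 0" for n p
    by (rule Der_generated[OF Der_combine[OF assms(1,2)]])
  then show ?thesis by (auto simp: fun_eq_iff)
qed

text \<open>Box representatives differ only by multiples t of the coboundary of v_0 (x) v_0, and ten
  coordinates determine them. Independence and spanning in cohomology thus become equations in these
  coordinates and t.\<close>

lemma H1_dimI:
  assumes D: "\<And>i. i < k \<Longrightarrow> ds i \<in> Der \<alpha> \<beta>" and B: "\<And>i. i < k \<Longrightarrow> box (ds i)"
    and I: "\<And>c t. coords (\<lambda>n p. \<Sum>i<k. c i * ds i n p) =
        coords (\<lambda>n p. t * tact \<alpha> \<beta> n (delta 0 0) p) \<Longrightarrow> \<forall>i<k. c i = 0"
    and S: "\<And>d. d \<in> Der \<alpha> \<beta> \<Longrightarrow> box d \<Longrightarrow> \<exists>c t. coords d =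
        coords (\<lambda>n p. (\<Sum>i<k. c i * ds i n p) + t * tact \<alpha> \<beta> n (delta 0 0) p)"
  shows "H1_dim \<alpha> \<beta> k"
  unfolding H1_dim_def
proof (intro exI[of _ ds] conjI allI ballI impI)
  fix c i
  assume "(\<lambda>n p. \<Sum>i<k. c i * ds i n p) \<in> Inn \<alpha> \<beta>" and "i < k"
  then obtain v where v: "fin_supp v" "(\<lambda>n p. \<Sum>i<k. c i * ds i n p) = (\<lambda>n. tact \<alpha> \<beta> n v)"
    by (auto simp: Inn_def)
  have "box (\<lambda>n. tact \<alpha> \<beta> n v)"
    using box_sum[of k ds c, OF B] unfolding v(2) .
  then obtain t where "v = (\<lambda>p. t * delta 0 0 p)"
    by (rule inner_box_unique[OF v(1)])
  then have "(\<lambda>n p. \<Sum>i<k. c i * ds i n p) = (\<lambda>n p. t * tact \<alpha> \<beta> n (delta 0 0) p)"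
    using tact_combine[of \<alpha> \<beta> _ "\<lambda>p. 0" t] unfolding v(2) by (intro ext) simp
  then show "c i = 0" using I[OF arg_cong[of _ _ coords]] \<open>i < k\<close> by blast
next
  fix d assume d: "d \<in> Der \<alpha> \<beta>"
  obtain v where v: "fin_supp v" "box (\<lambda>n p. d n p + tact \<alpha> \<beta> n v p)"
    by (rule box_reduce[OF d])
  let ?d = "\<lambda>n p. d n p + tact \<alpha> \<beta> n v p"
  have D': "?d \<in> Der \<alpha> \<beta>"
    using Der_combine[OF d inner_Der[OF v(1)], of 1] by simp
  then obtain c t where ct: "coords ?d =
      coords (\<lambda>n p. (\<Sum>i<k. c i * ds i n p) + t * tact \<alpha> \<beta> n (delta 0 0) p)"
    using S v(2) by blast
  have "?d = (\<lambda>n p. (\<Sum>i<k. c i * ds i n p) + t * tact \<alpha> \<beta> n (delta 0 0) p)"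
  proof (rule box_eqI[OF D' _ v(2) _ ct])
    show "(\<lambda>n p. (\<Sum>i<k. c i * ds i n p) + t * tact \<alpha> \<beta> n (delta 0 0) p) \<in> Der \<alpha> \<beta>"
      by (rule Der_combine[OF Der_sum inner_Der]) (simp_all add: D)
    show "box (\<lambda>n p. (\<Sum>i<k. c i * ds i n p) + t * tact \<alpha> \<beta> n (delta 0 0) p)"
      using box_sum[of k ds c, OF B] lower_delta[of 0 \<alpha> \<beta>] upper_delta[of 0 0 \<alpha> \<beta>]
        lower_combine upper_combine by simp
  qed
  then have e: "d n p + tact \<alpha> \<beta> n v p = (\<Sum>i<k. c i * ds i n p) + t * tact \<alpha> \<beta> n (delta 0 0) p" for n p
    by meson
  \<comment> \<open>The leading 0 puts both sums into the shape required by
    \<open>tact_combine\<close>.\<close>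
  let ?w = "\<lambda>p. (0 + t * delta 0 0 p) + (- 1) * v p"
  have "(\<lambda>n p. d n p - (\<Sum>i<k. c i * ds i n p)) = (\<lambda>n. tact \<alpha> \<beta> n ?w)"
  proof (intro ext)
    fix n p
    show "d n p - (\<Sum>i<k. c i * ds i n p) = tact \<alpha> \<beta> n ?w p"
      unfolding tact_combine using e[of n p] by (simp add: algebra_simps)
  qed
  moreover have "fin_supp ?w"
    by (intro fin_supp_combine v(1)) simp_all
  ultimately show "\<exists>c. (\<lambda>n p. d n p - (\<Sum>i<k. c i * ds i n p)) \<in> Inn \<alpha> \<beta>"
    unfolding Inn_def by blast
qed (use D in blast)

text \<open>The coboundary of v_0 (x) v_0 has first coordinate -beta, so for beta \<noteq> 0 a
  multiple of it clears the first coordinate of d.\<close>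

lemma H1_dimI_normalized:
  assumes "\<beta> \<noteq> 0"
    and D: "\<And>i. i < k \<Longrightarrow> ds i \<in> Der \<alpha> \<beta>" and B: "\<And>i. i < k \<Longrightarrow> box (ds i)"
    and I: "\<And>c t. coords (\<lambda>n p. \<Sum>i<k. c i * ds i n p) =
        coords (\<lambda>n p. t * tact \<alpha> \<beta> n (delta 0 0) p) \<Longrightarrow> \<forall>i<k. c i = 0"
    and S: "\<And>d. d \<in> Der \<alpha> \<beta> \<Longrightarrow> box d \<Longrightarrow> d 1 (0, 1) = 0 \<Longrightarrow> \<exists>c t. coords d =
        coords (\<lambda>n p. (\<Sum>i<k. c i * ds i n p) + t * tact \<alpha> \<beta> n (delta 0 0) p)"
  shows "H1_dim \<alpha> \<beta> k"
proof (rule H1_dimI[OF D B I])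
  fix d assume d: "d \<in> Der \<alpha> \<beta>" "box d"
  define s where "s = d 1 (0, 1) / \<beta>"
  let ?d = "\<lambda>n p. d n p + s * tact \<alpha> \<beta> n (delta 0 0) p"
  have "?d \<in> Der \<alpha> \<beta>"
    by (rule Der_combine[OF d(1) inner_Der]) simp
  moreover have "box ?d"
    using d(2) lower_delta[of 0 \<alpha> \<beta>] upper_delta[of 0 0 \<alpha> \<beta>] lower_combine upper_combine by simp
  moreover have "?d 1 (0, 1) = 0"
    using assms(1) by (simp add: s_def tact_apply delta_def)
  ultimately obtain c t where "coords ?d =
      coords (\<lambda>n p. (\<Sum>i<k. c i * ds i n p) + t * tact \<alpha> \<beta> n (delta 0 0) p)"
    using S by blast
  then have "coords d =
      coords (\<lambda>n p. (\<Sum>i<k. c i * ds i n p) + (t - s) * tact \<alpha> \<beta> n (delta 0 0) p)"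
    unfolding coords_def by (auto simp: left_diff_distrib eq_diff_eq add_diff_eq)
  then show "\<exists>c t. coords d =
      coords (\<lambda>n p. (\<Sum>i<k. c i * ds i n p) + t * tact \<alpha> \<beta> n (delta 0 0) p)"
    by blast
qed auto

section \<open>The linear relations between the coordinates\<close>

text \<open>Each relation is a cocycle identity at one basis vector: 1-2 come from (1, 0), 3-5 from
  (1, -1), 6-9 from (2, -1), 10-13 from (-2, 1) and 14-16 from (2, -2). Later proofs select them by
  position.\<close>

lemma box_relations:
  assumes d: "d \<in> Der \<alpha> \<beta>" and b: "box d"
  shows "\<alpha> * d 0 (0, 0) = 0" "\<beta> * d 0 (0, 0) = 0"
    "\<alpha> * d (- 1) (0, - 1) + \<beta> * d 1 (1, 0) = 0"
    "\<beta> * d (- 1) (- 1, 0) + \<alpha> * d 1 (0, 1) = 0"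
    "2 * d 0 (0, 0) = (1 - \<beta>) * (d (- 1) (0, - 1) + d 1 (0, 1)) + (1 - \<alpha>) * (d (- 1) (- 1, 0) + d 1 (1, 0))"
    "2 * \<alpha> * d (- 1) (0, - 1) + \<beta> * d 2 (2, 0) = 0"
    "3 * d 1 (0, 1) = (1 - 2 * \<beta>) * d (- 1) (0, - 1) + (2 - \<beta>) * d 2 (0, 2) + (1 - \<alpha>) * d 2 (1, 1)"
    "3 * d 1 (1, 0) = (1 - 2 * \<alpha>) * d (- 1) (- 1, 0) + (1 - \<beta>) * d 2 (1, 1) + (2 - \<alpha>) * d 2 (2, 0)"
    "2 * \<beta> * d (- 1) (- 1, 0) + \<alpha> * d 2 (0, 2) = 0"
    "2 * \<alpha> * d 1 (0, 1) + \<beta> * d (- 2) (- 2, 0) = 0"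
    "3 * d (- 1) (0, - 1) = (1 - 2 * \<beta>) * d 1 (0, 1) + (2 - \<beta>) * d (- 2) (0, - 2) + (1 - \<alpha>) * d (- 2) (- 1, - 1)"
    "3 * d (- 1) (- 1, 0) = (1 - 2 * \<alpha>) * d 1 (1, 0) + (1 - \<beta>) * d (- 2) (- 1, - 1) + (2 - \<alpha>) * d (- 2) (- 2, 0)"
    "2 * \<beta> * d 1 (1, 0) + \<alpha> * d (- 2) (0, - 2) = 0"
    "(1 - 2 * \<alpha>) * d (- 2) (- 1, - 1) + (1 - 2 * \<beta>) * d 2 (1, 1) = 0"
    "(1 - 2 * \<beta>) * d (- 2) (- 1, - 1) + (1 - 2 * \<alpha>) * d 2 (1, 1) = 0"
    "2 * d 0 (0, 0) = (1 - \<beta>) * (d (- 2) (0, - 2) + d 2 (0, 2)) + (1 - \<alpha>) * (d (- 2) (- 2, 0) + d 2 (2, 0))"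
proof -
  note br = Der_bracket[OF d] and v = box_vanish[OF b]
  show "\<alpha> * d 0 (0, 0) = 0"
    using br[of 1 0 1 0] by (simp add: v)
  show "\<beta> * d 0 (0, 0) = 0"
    using br[of 1 0 0 1] by (simp add: v)
  show "\<alpha> * d (- 1) (0, - 1) + \<beta> * d 1 (1, 0) = 0"
    using br[of 1 "- 1" 1 "- 1"] by (simp add: v; (algebra | simp add: algebra_simps))
  show "\<beta> * d (- 1) (- 1, 0) + \<alpha> * d 1 (0, 1) = 0"
    using br[of 1 "- 1" "- 1" 1] by (simp add: v; (algebra | simp add: algebra_simps))
  show "2 * d 0 (0, 0) = (1 - \<beta>) * (d (- 1) (0, - 1) + d 1 (0, 1)) + (1 - \<alpha>) * (d (- 1) (- 1, 0) + d 1 (1, 0))"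
    using br[of 1 "- 1" 0 0] by (simp add: v algebra_simps)
  show "2 * \<alpha> * d (- 1) (0, - 1) + \<beta> * d 2 (2, 0) = 0"
    using br[of 2 "- 1" 2 "- 1"] by (simp add: v; (algebra | simp add: algebra_simps))
  show "3 * d 1 (0, 1) = (1 - 2 * \<beta>) * d (- 1) (0, - 1) + (2 - \<beta>) * d 2 (0, 2) + (1 - \<alpha>) * d 2 (1, 1)"
    using br[of 2 "- 1" 0 1] by (simp add: v; (algebra | simp add: algebra_simps))
  show "3 * d 1 (1, 0) = (1 - 2 * \<alpha>) * d (- 1) (- 1, 0) + (1 - \<beta>) * d 2 (1, 1) + (2 - \<alpha>) * d 2 (2, 0)"
    using br[of 2 "- 1" 1 0] by (simp add: v; (algebra | simp add: algebra_simps))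
  show "2 * \<beta> * d (- 1) (- 1, 0) + \<alpha> * d 2 (0, 2) = 0"
    using br[of 2 "- 1" "- 1" 2] by (simp add: v; (algebra | simp add: algebra_simps))
  show "2 * \<alpha> * d 1 (0, 1) + \<beta> * d (- 2) (- 2, 0) = 0"
    using br[of "- 2" 1 "- 2" 1] by (simp add: v; (algebra | simp add: algebra_simps))
  show "3 * d (- 1) (0, - 1) = (1 - 2 * \<beta>) * d 1 (0, 1) + (2 - \<beta>) * d (- 2) (0, - 2) + (1 - \<alpha>) * d (- 2) (- 1, - 1)"
    using br[of "- 2" 1 0 "- 1"] by (simp add: v; (algebra | simp add: algebra_simps))
  show "3 * d (- 1) (- 1, 0) = (1 - 2 * \<alpha>) * d 1 (1, 0) + (1 - \<beta>) * d (- 2) (- 1, - 1) + (2 - \<alpha>) * d (- 2) (- 2, 0)"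
    using br[of "- 2" 1 "- 1" 0] by (simp add: v; (algebra | simp add: algebra_simps))
  show "2 * \<beta> * d 1 (1, 0) + \<alpha> * d (- 2) (0, - 2) = 0"
    using br[of "- 2" 1 1 "- 2"] by (simp add: v; (algebra | simp add: algebra_simps))
  show "(1 - 2 * \<alpha>) * d (- 2) (- 1, - 1) + (1 - 2 * \<beta>) * d 2 (1, 1) = 0"
    using br[of 2 "- 2" 1 "- 1"] by (simp add: v; (algebra | simp add: algebra_simps))
  show "(1 - 2 * \<beta>) * d (- 2) (- 1, - 1) + (1 - 2 * \<alpha>) * d 2 (1, 1) = 0"
    using br[of 2 "- 2" "- 1" 1] by (simp add: v; (algebra | simp add: algebra_simps))
  show "2 * d 0 (0, 0) = (1 - \<beta>) * (d (- 2) (0, - 2) + d 2 (0, 2)) + (1 - \<alpha>) * (d (- 2) (- 2, 0) + d 2 (2, 0))"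
    using br[of 2 "- 2" 0 0] by (simp add: v; (algebra | simp add: algebra_simps))
qed

section \<open>Explicit cocycles\<close>

text \<open>The element half_diag has infinite support, so its coboundary, which is finitely supported
for suitable weights, need not be inner.\<close>

definition half_diag :: "(int \<Rightarrow> complex) \<Rightarrow> tens" where
  "half_diag w = (\<lambda>(a, b). if a + b = 0 \<and> a > 0 then w a else 0)"

text \<open>Above the box both terms of the action come from positive indices, and the hypothesis
  says that they cancel. Inside the box at most one of the two indices is positive, and below it
  neither is.\<close>

lemma half_diag_box:
  assumes "\<And>a m. 0 < a \<Longrightarrow> m < a \<Longrightarrow>
    (of_int (a - m) + \<alpha> * of_int m) * w (a - m) = (of_int a - \<beta> * of_int m) * w a"
  shows "box (\<lambda>m. tact \<alpha> \<beta> m (half_diag w))"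
proof -
  have "a + b = m \<and> min 0 m \<le> a \<and> a \<le> max 0 m"
    if nz: "tact \<alpha> \<beta> m (half_diag w) (a, b) \<noteq> 0" for m a b
  proof -
    have ab: "a + b = m"
      using nz by (auto simp: tact_apply half_diag_def split: if_splits)
    have lo: "min 0 m \<le> a"
      using nz by (auto simp: tact_apply half_diag_def split: if_splits)
    have "\<not> max 0 m < a"
    proof
      assume "max 0 m < a"
      moreover have "b = m - a" using ab by simp
      ultimately show False
        using nz assms[of a m] unfolding \<open>b = m - a\<close>
        by (simp add: tact_apply half_diag_def) (simp add: algebra_simps)
    qed
    then show ?thesis using ab lo by linarith
  qed
  then show ?thesis unfolding lower_def upper_def by simp
qed

lemma half_diag_Der:
  assumes "box (\<lambda>m. tact \<alpha> \<beta> m (half_diag w))"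
  shows "(\<lambda>m. tact \<alpha> \<beta> m (half_diag w)) \<in> Der \<alpha> \<beta>"
  using fin_supp_box[OF assms] by (rule tact_Der)

text \<open>W kills the vector v_0 of F_0, so v_0 (x) F_beta is a copy of F_beta inside F_0 (x)
  F_beta. For alpha = 0 this is the cochain sending L_n to f(n) v_n in that copy.\<close>

definition right_edge :: "(int \<Rightarrow> complex) \<Rightarrow> int \<Rightarrow> tens" where
  "right_edge f n = (\<lambda>(a, b). if a = 0 \<and> b = n then f n else 0)"

lemma right_edge_box: "box (right_edge f)"
  unfolding lower_def upper_def right_edge_def by auto

lemma right_edge_Der:
  assumes "\<And>m n. of_int (m - n) * f (m + n) =
    (of_int m + \<beta> * of_int n) * f m - (of_int n + \<beta> * of_int m) * f n"
  shows "right_edge f \<in> Der 0 \<beta>"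
proof -
  have t: "tact 0 \<beta> m (right_edge f n) (a, b) =
      (if a = 0 \<and> b = m + n then - (of_int n + \<beta> * of_int m) * f n else 0)" for m n a b
  proof -
    have 1: "of_int (a - m) * right_edge f n (a - m, b) = 0"
      by (simp add: right_edge_def)
    have 2: "right_edge f n (a, b - m) = (if a = 0 \<and> b = m + n then f n else 0)"
      by (auto simp: right_edge_def)
    have 3: "tact 0 \<beta> m (right_edge f n) (a, b) = - (of_int (a - m) * right_edge f n (a - m, b))
        - (of_int (b - m) + \<beta> * of_int m) * right_edge f n (a, b - m)"
      unfolding tact_apply by (simp del: of_int_diff)
    show ?thesis
      unfolding 3 1 2 by (simp add: algebra_simps)
  qed
  have "of_int (m - n) * right_edge f (m + n) (a, b) =
      tact 0 \<beta> m (right_edge f n) (a, b) - tact 0 \<beta> n (right_edge f m) (a, b)" for m n a b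
    using assms[of m n] unfolding t by (simp add: right_edge_def add.commute) (simp add: algebra_simps)
  then show ?thesis
    using fin_supp_box[OF right_edge_box[of f]] unfolding Der_def by (simp only: split_paired_All mem_Collect_eq) blast
qed

lemmas coords_simps =
  coords_def right_edge_def swap_def tact_apply half_diag_def delta_def

section \<open>The dimension for each pair of weights\<close>

text \<open>The cocycles f(n) = 1 and f(n) = n of F_0 appear once for each factor; the fifth class
  is the logarithm, w(i) = 1/i. The coboundary of v_0 (x) v_0 is zero here, so nothing can be
  normalized.\<close>

lemma H1_dim_0_0: "H1_dim 0 0 5"
proof (rule H1_dimI)
  let ?ds = "\<lambda>i. [right_edge (\<lambda>n. 1), right_edge of_int, swap (right_edge (\<lambda>n. 1)),
    swap (right_edge of_int), \<lambda>m. tact 0 0 m (half_diag (\<lambda>i. 1 / of_int i))] ! i"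
  have hb: "box (\<lambda>m. tact 0 0 m (half_diag (\<lambda>i. 1 / of_int i)))"
    by (rule half_diag_box) (simp add: field_simps)
  have eb: "box (swap (right_edge f))" for f
    using lower_swap[of 0 "right_edge f"] upper_swap[of 0 "right_edge f"] right_edge_box[of f] by simp
  have e: "right_edge (\<lambda>n. 1) \<in> Der 0 0" "right_edge of_int \<in> Der 0 0"
    by (rule right_edge_Der; simp add: algebra_simps)+
  show "?ds i \<in> Der 0 0" if "i < 5" for i
    using that e e[THEN swap_Der] half_diag_Der[OF hb] by (auto simp: eval_nat_numeral less_Suc_eq)
  show "box (?ds i)" if "i < 5" for i
    using that hb eb right_edge_box by (auto simp: eval_nat_numeral less_Suc_eq)
  show "\<forall>i<5. c i = 0"
    if "coords (\<lambda>n p. \<Sum>i<5. c i * ?ds i n p) = coords (\<lambda>n p. t * tact 0 0 n (delta 0 0) p)" for c t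
  proof -
    note h = arg_cong[OF that, of "\<lambda>l. l ! _"]
    \<comment> \<open>Entry 3 is the degree 2 coefficient at (1, 1), where the edge cocycles vanish;
      it isolates the logarithm.\<close>
    have h: "c 4 = 0" "c 0 + c 1 = 0" "c 0 + c 1 * 2 = 0" "c 2 + c 3 + c 4 = 0" "c 2 = c 3"
      using h[of 3] h[of 0] h[of 2] h[of 1] h[of 6]
      by (simp_all add: coords_simps eval_nat_numeral)
    have "c 1 = 0" "c 3 = 0" using h by algebra+
    with h show ?thesis by (auto simp: eval_nat_numeral less_Suc_eq)
  qed
  show "\<exists>c t. coords d = coords (\<lambda>n p. (\<Sum>i<5. c i * ?ds i n p) + t * tact 0 0 n (delta 0 0) p)"
    if "d \<in> Der 0 0" "box d" for d
  proof -
    note r = box_relations[OF that]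
    define E where "E = d 2 (1, 1)"
    have y: "d (- 2) (- 1, - 1) = - E"
      using r(14) by (simp add: E_def add_eq_0_iff2)
    have x2: "d 2 (0, 2) = (3 * d 1 (0, 1) - d (- 1) (0, - 1) - E) / 2"
        "d 2 (2, 0) = (3 * d 1 (1, 0) - d (- 1) (- 1, 0) - E) / 2"
        "d (- 2) (0, - 2) = (3 * d (- 1) (0, - 1) - d 1 (0, 1) + E) / 2"
        "d (- 2) (- 2, 0) = (3 * d (- 1) (- 1, 0) - d 1 (1, 0) + E) / 2"
      using r(7,8,11,12) by (simp_all add: E_def[symmetric] y)
    \<comment> \<open>The logarithm has coefficient 1 at (1, 1) in degree 2, which gives E. It also
      contributes 1 at (1, 0) in degree 1 and -1 at (0, -1) in degree -1; after this correction half
      sums and half differences of the entries in degrees 1 and -1 give the rest.\<close>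
    let ?c = "\<lambda>i. [(d 1 (0, 1) + d (- 1) (0, - 1) + E) / 2, (d 1 (0, 1) - d (- 1) (0, - 1) - E) / 2,
      (d 1 (1, 0) + d (- 1) (- 1, 0) - E) / 2, (d 1 (1, 0) - d (- 1) (- 1, 0) - E) / 2, E] ! i"
    have "coords d = coords (\<lambda>n p. (\<Sum>i<5. ?c i * ?ds i n p) + 0 * tact 0 0 n (delta 0 0) p)"
      by (simp add: coords_simps eval_nat_numeral x2 y E_def[symmetric]) (simp add: field_simps)
    then show ?thesis by (intro exI)
  qed
qed

lemma H1_dim_0_1: "H1_dim 0 1 2"
proof (rule H1_dimI_normalized)
  let ?ds = "\<lambda>i. [\<lambda>m. tact 0 1 m (half_diag (\<lambda>i. 1)), right_edge (\<lambda>n. of_int (n\<^sup>2))] ! i"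
  have hb: "box (\<lambda>m. tact 0 1 m (half_diag (\<lambda>i. 1)))"
    by (rule half_diag_box) simp
  have e: "right_edge (\<lambda>n. of_int (n\<^sup>2)) \<in> Der 0 1"
    by (rule right_edge_Der) (simp add: algebra_simps power2_eq_square)
  show "?ds i \<in> Der 0 1" if "i < 2" for i
    using that e half_diag_Der[OF hb] by (auto simp: eval_nat_numeral less_Suc_eq)
  show "box (?ds i)" if "i < 2" for i
    using that hb right_edge_box by (auto simp: eval_nat_numeral less_Suc_eq)
  show "\<forall>i<2. c i = 0"
    if "coords (\<lambda>n p. \<Sum>i<2. c i * ?ds i n p) = coords (\<lambda>n p. t * tact 0 1 n (delta 0 0) p)" for c t
  proof -
    note h = arg_cong[OF that, of "\<lambda>l. l ! _"]
    have "c 0 = 0" "c 1 = - t"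
      using h[of 3] h[of 0] by (simp_all add: coords_simps eval_nat_numeral)
    moreover have "2 * c 1 = - t"
      using h[of 2] by (simp add: coords_simps eval_nat_numeral)
    ultimately have h: "c 0 = 0" "c 1 = 0" by algebra+
    then show ?thesis by (auto simp: eval_nat_numeral less_Suc_eq)
  qed
  show "\<exists>c t. coords d = coords (\<lambda>n p. (\<Sum>i<2. c i * ?ds i n p) + t * tact 0 1 n (delta 0 0) p)"
    if "d \<in> Der 0 1" "box d" and z: "d 1 (0, 1) = 0" for d
  proof -
    note r = box_relations[OF that(1,2), simplified z]
    define u v where "u = d 2 (1, 1)" and "v = d 2 (0, 2)"
    have x: "d 1 (1, 0) = 0" "d (- 1) (- 1, 0) = 0" "d 2 (2, 0) = 0" "d (- 2) (- 2, 0) = 0"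
      using r(3,4,6,10) by simp_all
    have y: "d (- 2) (- 1, - 1) = u" "d (- 1) (0, - 1) = u + v"
      using r(14) r(7) unfolding u_def v_def by (simp, algebra)
    have y2: "d (- 2) (0, - 2) = 2 * u + 3 * v"
      using r(11) by (simp add: y)
    \<comment> \<open>The half diagonal contributes -1 at (1, 1) in degree 2. The edge part must be
      0 at n = 1 and v at n = 2, hence v (n^2 - n)/2, where the term in n is the coboundary of v_0
      (x) v_0.\<close>
    let ?c = "\<lambda>i. [- u, v / 2] ! i"
    have "coords d = coords (\<lambda>n p. (\<Sum>i<2. ?c i * ?ds i n p) + v / 2 * tact 0 1 n (delta 0 0) p)"
      by (simp add: coords_simps eval_nat_numeral x y y2 z u_def[symmetric] v_def[symmetric])
    then show ?thesis by (intro exI)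
  qed
qed simp

lemma H1_dim_0_2: "H1_dim 0 2 1"
proof (rule H1_dimI_normalized)
  let ?ds = "\<lambda>i :: nat. right_edge (\<lambda>n. of_int (n ^ 3))"
  show "?ds i \<in> Der 0 2" for i
    by (rule right_edge_Der) (simp add: algebra_simps power3_eq_cube)
  show "box (?ds i)" for i
    by (rule right_edge_box)
  show "\<forall>i<1. c i = 0"
    if "coords (\<lambda>n p. \<Sum>i<1. c i * ?ds i n p) = coords (\<lambda>n p. t * tact 0 2 n (delta 0 0) p)" for c t
  proof -
    note h = arg_cong[OF that, of "\<lambda>l. l ! _"]
    have "c 0 = - (t * 2)"
      using h[of 0] by (simp add: coords_simps)
    moreover have "2 * c 0 = - t"
      using h[of 2] by (simp add: coords_simps)
    ultimately have "c 0 = 0" by algebra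
    then show ?thesis by simp
  qed
  show "\<exists>c t. coords d = coords (\<lambda>n p. (\<Sum>i<1. c i * ?ds i n p) + t * tact 0 2 n (delta 0 0) p)"
    if "d \<in> Der 0 2" "box d" and z: "d 1 (0, 1) = 0" for d
  proof -
    note r = box_relations[OF that(1,2), simplified z]
    have x: "d 1 (1, 0) = 0" "d (- 1) (- 1, 0) = 0" "d 2 (2, 0) = 0" "d (- 2) (- 2, 0) = 0" "d 0 (0, 0) = 0"
      using r(2,3,4,6,10) by simp_all
    have y: "d (- 1) (0, - 1) = 0" "d 2 (1, 1) = 0" "d (- 2) (- 1, - 1) = 0"
      using r(5,8,12) by (simp_all add: x)
    \<comment> \<open>For beta = 2 the factor 2 - beta removes these entries from the identities for
      (2, -1) and (-2, 1); the identity for (2, -2) links them.\<close>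
    have y2: "d (- 2) (0, - 2) = - d 2 (0, 2)"
      using r(16) unfolding x by algebra
    \<comment> \<open>The combination is (n^3 - n)/6 times \<open>d 2 (0, 2)\<close>, where (n^3 -
      n)/6 is 0 at n = 1 and 1 at n = 2.\<close>
    have "coords d = coords (\<lambda>n p. (\<Sum>i<1. d 2 (0, 2) / 6 * ?ds i n p) + d 2 (0, 2) / 12 * tact 0 2 n (delta 0 0) p)"
      by (simp add: coords_simps x y y2 z)
    then show ?thesis by (intro exI)
  qed
qed simp

text \<open>The scale of q makes it the coefficient of the half-diagonal cocycle with constant
  weight when alpha + beta = 1. All coordinates but the two at (1, 1) and (-1, -1) are multiples of
  q, and the last relation restricts the weights for which q can be nonzero.\<close>

lemma normalized_relations:
  assumes d: "d \<in> Der \<alpha> \<beta>" "box d" and z: "d 1 (0, 1) = 0" and nz: "\<alpha> \<noteq> 0" "\<beta> \<noteq> 0"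
  defines "q \<equiv> - d (- 1) (0, - 1) / \<beta>"
  shows "d (- 1) (- 1, 0) = 0" "d (- 2) (- 2, 0) = 0" "d 2 (0, 2) = 0"
    "d (- 1) (0, - 1) = - \<beta> * q" "d 1 (1, 0) = \<alpha> * q" "d 2 (2, 0) = 2 * \<alpha> * q"
    "d (- 2) (0, - 2) = - 2 * \<beta> * q"
    "(1 - \<alpha>) * d 2 (1, 1) = (1 - 2 * \<beta>) * \<beta> * q"
    "(1 - \<beta>) * d 2 (1, 1) = (2 * \<alpha> - 1) * \<alpha> * q"
    "(1 - \<alpha>) * d (- 2) (- 1, - 1) = (1 - 2 * \<beta>) * \<beta> * q"
    "(1 - \<beta>) * d (- 2) (- 1, - 1) = (2 * \<alpha> - 1) * \<alpha> * q"
    "(\<alpha> - \<beta>) * (1 - \<alpha> - \<beta>) * q = 0"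
proof -
  note r = box_relations[OF d, unfolded z]
  have e: "d 0 (0, 0) = 0" using r(1) nz by simp
  show 1: "d (- 1) (- 1, 0) = 0" "d (- 2) (- 2, 0) = 0" using r(4,10) nz by simp_all
  show 2: "d 2 (0, 2) = 0" using r(9) nz 1 by simp
  show 3: "d (- 1) (0, - 1) = - \<beta> * q" using nz by (simp add: q_def)
  have "\<beta> * (d 1 (1, 0) - \<alpha> * q) = 0" using r(3) unfolding 3 by (simp add: algebra_simps)
  then show 4: "d 1 (1, 0) = \<alpha> * q" using nz by simp
  have "\<beta> * (d 2 (2, 0) - 2 * \<alpha> * q) = 0" using r(6) unfolding 3 by (simp add: algebra_simps)
  then show 5: "d 2 (2, 0) = 2 * \<alpha> * q" using nz by simp
  have "\<alpha> * (d (- 2) (0, - 2) + 2 * \<beta> * q) = 0" using r(13) unfolding 4 by (simp add: algebra_simps)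
  then show 6: "d (- 2) (0, - 2) = - 2 * \<beta> * q" using nz by (simp add: add_eq_0_iff2)
  show "(1 - \<alpha>) * d 2 (1, 1) = (1 - 2 * \<beta>) * \<beta> * q"
    using r(7) unfolding 2 3 by (simp add: algebra_simps)
  show "(1 - \<beta>) * d 2 (1, 1) = (2 * \<alpha> - 1) * \<alpha> * q"
    using r(8) unfolding 1 4 5 by (simp add: algebra_simps)
  show "(1 - \<alpha>) * d (- 2) (- 1, - 1) = (1 - 2 * \<beta>) * \<beta> * q"
    using r(11) unfolding 3 6 by (simp add: algebra_simps)
  show "(1 - \<beta>) * d (- 2) (- 1, - 1) = (2 * \<alpha> - 1) * \<alpha> * q"
    using r(12) unfolding 1 4 by (simp add: algebra_simps)
  show "(\<alpha> - \<beta>) * (1 - \<alpha> - \<beta>) * q = 0"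
    using r(5) unfolding 1 3 4 e by (simp add: algebra_simps)
qed

text \<open>For w = 1 the cancellation condition of \<open>half_diag_box\<close> reads alpha = 1 -
  beta; this is the expansion of 1/(x-y).\<close>

lemma H1_dim_sum_one:
  assumes nz: "\<alpha> \<noteq> 0" "\<beta> \<noteq> 0" and s: "\<alpha> + \<beta> = 1"
  shows "H1_dim \<alpha> \<beta> 1"
proof (rule H1_dimI_normalized)
  let ?ds = "\<lambda>i :: nat. \<lambda>m. tact \<alpha> \<beta> m (half_diag (\<lambda>i. 1))"
  have \<alpha>: "\<alpha> = 1 - \<beta>" using s by (simp add: algebra_simps)
  have hb: "box (\<lambda>m. tact \<alpha> \<beta> m (half_diag (\<lambda>i. 1)))"
    by (rule half_diag_box) (simp add: \<alpha> algebra_simps)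
  show "box (?ds i)" for i by (rule hb)
  show "?ds i \<in> Der \<alpha> \<beta>" for i by (rule half_diag_Der[OF hb])
  show "\<forall>i<1. c i = 0"
    if "coords (\<lambda>n p. \<Sum>i<1. c i * ?ds i n p) = coords (\<lambda>n p. t * tact \<alpha> \<beta> n (delta 0 0) p)" for c t
  proof -
    from that have "t = 0" "c 0 * (1 - \<beta>) = - (t * \<alpha>)"
      using nz by (simp_all add: coords_simps)
    then show ?thesis using nz \<alpha> by simp
  qed
  show "\<exists>c t. coords d = coords (\<lambda>n p. (\<Sum>i<1. c i * ?ds i n p) + t * tact \<alpha> \<beta> n (delta 0 0) p)"
    if d: "d \<in> Der \<alpha> \<beta>" "box d" and z: "d 1 (0, 1) = 0" for d
  proof -
    define q where "q = - d (- 1) (0, - 1) / \<beta>"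
    note r = normalized_relations[OF d z nz, folded q_def]
    have x: "d 2 (1, 1) = (1 - 2 * \<beta>) * q" "d (- 2) (- 1, - 1) = (1 - 2 * \<beta>) * q"
      using r(8,10) nz by (simp_all add: \<alpha>)
    have "coords d = coords (\<lambda>n p. (\<Sum>i<1. q * ?ds i n p) + 0 * tact \<alpha> \<beta> n (delta 0 0) p)"
      by (simp add: coords_simps r(1-7) x z) (simp add: \<alpha> algebra_simps)
    then show ?thesis by (intro exI)
  qed
qed (rule nz)

text \<open>If q \<noteq> 0, then alpha = beta. The two equations for \<open>d 2 (1, 1)\<close> then
  have equal left sides and opposite right sides, so alpha = 1/2 and the sum is 1 after all.\<close>

lemma normalized_vanish:
  assumes d: "d \<in> Der \<alpha> \<beta>" "box d" and z: "d 1 (0, 1) = 0"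
    and nz: "\<alpha> \<noteq> 0" "\<beta> \<noteq> 0" and s: "\<alpha> + \<beta> \<noteq> 1"
  shows "d (- 1) (0, - 1) = 0"
proof (rule ccontr)
  assume n: "d (- 1) (0, - 1) \<noteq> 0"
  define q where "q = - d (- 1) (0, - 1) / \<beta>"
  note r = normalized_relations[OF d z nz, folded q_def]
  have q: "q \<noteq> 0" using n nz by (simp add: q_def)
  have "1 - \<alpha> - \<beta> \<noteq> 0" using s by (simp add: algebra_simps)
  then have "\<alpha> = \<beta>" using r(12) q by simp
  then have "(1 - 2 * \<alpha>) * \<alpha> * q = (2 * \<alpha> - 1) * \<alpha> * q" using r(8,9) by simp
  then have "1 - 2 * \<alpha> = 2 * \<alpha> - 1" using q nz by simp
  then have "\<alpha> + \<beta> = 1" using \<open>\<alpha> = \<beta>\<close> by (simp add: algebra_simps)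
  then show False using s by simp
qed

lemma H1_dim_1_1: "H1_dim 1 1 1"
proof (rule H1_dimI_normalized)
  let ?ds = "\<lambda>i :: nat. \<lambda>m. tact 1 1 m (half_diag of_int)"
  have hb: "box (\<lambda>m. tact 1 1 m (half_diag of_int))"
    by (rule half_diag_box) (simp add: algebra_simps)
  show "box (?ds i)" for i by (rule hb)
  show "?ds i \<in> Der 1 1" for i by (rule half_diag_Der[OF hb])
  show "\<forall>i<1. c i = 0"
    if "coords (\<lambda>n p. \<Sum>i<1. c i * ?ds i n p) = coords (\<lambda>n p. t * tact 1 1 n (delta 0 0) p)" for c t
    using that by (simp add: coords_simps)
  show "\<exists>c t. coords d = coords (\<lambda>n p. (\<Sum>i<1. c i * ?ds i n p) + t * tact 1 1 n (delta 0 0) p)"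
    if d: "d \<in> Der 1 1" "box d" and z: "d 1 (0, 1) = 0" for d
  proof -
    have q: "d (- 1) (0, - 1) = 0" by (rule normalized_vanish[OF d z]) simp_all
    note r = normalized_relations[OF d z _ _, simplified q, simplified]
    \<comment> \<open>Since 1 - alpha = 1 - beta = 0, the middle entries drop out of the identities
      for (2, -1) and (-2, 1). The identity for (2, -2) makes them opposite, leaving the single
      class w(i) = i.\<close>
    have y: "d (- 2) (- 1, - 1) = - d 2 (1, 1)"
      using box_relations(14)[OF d] by algebra
    have "coords d = coords (\<lambda>n p. (\<Sum>i<1. (- d 2 (1, 1)) * ?ds i n p) + 0 * tact 1 1 n (delta 0 0) p)"
      by (simp add: coords_simps r q y z)
    then show ?thesis by (intro exI)
  qed
qed simp

text \<open>For alpha = 0 the exclusions keep 1 - beta and 2 - beta nonzero; for alpha \<noteq> 0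
  they force q = 0 and keep one of 1 - alpha, 1 - beta nonzero. These factors then kill every
  coordinate.\<close>

lemma H1_dim_generic:
  assumes "\<beta> \<noteq> 0" "\<alpha> + \<beta> \<noteq> 1" "(\<alpha>, \<beta>) \<noteq> (0, 2)" "(\<alpha>, \<beta>) \<noteq> (1, 1)"
  shows "H1_dim \<alpha> \<beta> 0"
proof (rule H1_dimI_normalized[OF assms(1)])
  show "\<exists>c t. coords d = coords (\<lambda>n p. (\<Sum>i<0. c i * undefined i n p) + t * tact \<alpha> \<beta> n (delta 0 0) p)"
    if d: "d \<in> Der \<alpha> \<beta>" "box d" and z: "d 1 (0, 1) = 0" for d
  proof -
    have "coords d = coords (\<lambda>n p. 0)"
    proof (cases "\<alpha> = 0")
      case True
      note r = box_relations[OF d, simplified z True]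
      have \<beta>: "1 - \<beta> \<noteq> 0" "2 - \<beta> \<noteq> 0" using assms True by auto
      have x: "d 1 (1, 0) = 0" "d (- 1) (- 1, 0) = 0" "d 2 (2, 0) = 0" "d (- 2) (- 2, 0) = 0" "d 0 (0, 0) = 0"
        using r(2,3,4,6,10) assms(1) by simp_all
      have y: "d (- 1) (0, - 1) = 0" "d 2 (1, 1) = 0" "d (- 2) (- 1, - 1) = 0"
        using r(5,8,12) \<beta> by (simp_all add: x)
      have "d 2 (0, 2) = 0" "d (- 2) (0, - 2) = 0"
        using r(7,11) \<beta> by (simp_all add: x y)
      then show ?thesis by (simp add: coords_def x y z)
    next
      case False
      have q: "d (- 1) (0, - 1) = 0" by (rule normalized_vanish[OF d z False assms(1,2)])
      note r = normalized_relations[OF d z False assms(1), simplified q, simplified]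
      have "1 - \<alpha> \<noteq> 0 \<or> 1 - \<beta> \<noteq> 0" using assms(4) by auto
      then have "d 2 (1, 1) = 0" "d (- 2) (- 1, - 1) = 0" using r(8-11) by auto
      then show ?thesis by (simp add: coords_def r q z)
    qed
    then show ?thesis by (intro exI[of _ "\<lambda>_. 0"] exI[of _ 0]) (simp add: coords_def)
  qed
qed auto

section \<open>Assembling the cases\<close>

theorem theoremT:
  fixes \<alpha> \<beta> :: complex
  shows "H1_dim \<alpha> \<beta>
    (if (\<alpha>, \<beta>) = (0, 0) then 5
     else if (\<alpha>, \<beta>) = (0, 1) \<or> (\<alpha>, \<beta>) = (1, 0) then 2
     else if (\<alpha>, \<beta>) \<in> {(0, 2), (2, 0), (1, 1)} \<or> (\<alpha> + \<beta> = 1 \<and> \<beta> \<noteq> 0 \<and> \<beta> \<noteq> 1) then 1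
     else 0)"
proof (cases "\<beta> = 0")
  case True
  \<comment> \<open>The normalization needs a nonzero second weight; for beta = 0 and alpha \<noteq>
    0 the flip provides one.\<close>
  show ?thesis
  proof (cases "\<alpha> \<in> {0, 1, 2}")
    case T: True
    then show ?thesis
      using True H1_dim_0_0 H1_dim_0_1[THEN H1_dim_swap] H1_dim_0_2[THEN H1_dim_swap] by auto
  next
    case False
    then have "H1_dim 0 \<alpha> 0" by (intro H1_dim_generic) auto
    then show ?thesis using True False H1_dim_swap by auto
  qed
next
  case False
  consider "\<alpha> = 0" "\<beta> = 1" | "\<alpha> = 0" "\<beta> = 2" | "\<alpha> = 1" "\<beta> = 1"
    | "\<alpha> \<noteq> 0" "\<alpha> + \<beta> = 1" | "\<alpha> + \<beta> \<noteq> 1" "(\<alpha>, \<beta>) \<noteq> (0, 2)" "(\<alpha>, \<beta>) \<noteq> (1, 1)"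
    by fastforce
  then show ?thesis
  proof cases
    case 4
    then show ?thesis using False H1_dim_sum_one by auto
  next
    case 5
    then show ?thesis using False H1_dim_generic[of \<beta> \<alpha>] by auto
  qed (use H1_dim_0_1 H1_dim_0_2 H1_dim_1_1 in auto)
qed

end
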